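(* Suppose $f:\mathbb{R}^{m\times n}\to\mathbb{R}$ is twice continuously differentiable on $\mathbb{R}^{m\times n}$. If $X\in\mathcal{L}\cap\mathbb{R}(r)$, with a fixed singular value decomposition $X=U\Sigma(X)V^\top$, is a local minimizer of the problem (rank-MOA) of minimizing $f$ over $\mathcal{L}\cap\mathbb{R}(r)$, and Assumption 2 holds at $X$ (i.e. the matrices $R^1_X,\dots,R^l_X$ are linearly independent), then $$[\nabla^2f(X)](\Xi,\Xi)\ge 0\qquad\forall\,\Xi\in\mathrm{T}_{\mathcal{L}}(X)\cap\mathrm{T}^B_{\mathbb{R}_X(r)}(X),$$ where $\nabla^2f(X)$ is the Hessian of $f$ at $X$ (as a bilinear form).
   Context: Let $m\ge n$ and $1\le r<n$ be integers. $\mathbb{R}^{m\times n}$ carries the inner product $\langle X,Y\rangle=\sum_{ij}X_{ij}Y_{ij}$. Given $A^1,\dots,A^l\in\mathbb{R}^{m\times n}$ and $b_1,\dots,b_l\in\mathbb{R}$, set $\mathcal{L}=\{X\in\mathbb{R}^{m\times n}:\langle A^i,X\rangle=b_i,\ i=1,\dots,l\}$ and $\mathbb{R}(r)=\{X\in\mathbb{R}^{m\times n}:\mathrm{rank}(X)\le r\}$. For a nonempty closed set $\Omega\subseteq\mathbb{R}^{m\times n}$ and $X\in\Omega$, the Bouligand tangent cone $\mathrm{T}^B_\Omega(X)$ is the set of all $\Xi$ for which there are $X^k\in\Omega$ with $X^k\to X$ and $t_k>0$ with $t_k\to0$ such that $t_k^{-1}(X^k-X)\to\Xi$. For the affine set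 $\mathcal{L}$ one writes $\mathrm{T}_{\mathcal{L}}(X)=\mathrm{T}^B_{\mathcal{L}}(X)$. For $X\in\mathbb{R}^{m\times n}$ of rank $s$ fix an SVD $X=U\Sigma(X)V^\top$, with $U\in\mathbb{R}^{m\times m}$, $V\in\mathbb{R}^{n\times n}$ orthogonal and $\Sigma(X)$ the (rectangular) diagonal $m\times n$ matrix of singular values; $\Gamma\subseteq\{1,\dots,n\}$, $|\Gamma|=s$, is the index set of the nonzero singular values. For an index set $J$, $U_J$ (resp. $V_J$) is the submatrix of columns of $U$ (resp. $V$) indexed by $J$. Let $\mathcal{J}=\{J\subseteq\{1,\dots,n\}:|J|=r,\ \Gamma\subseteq J\}$, $\mathbb{R}_X(J)=\{U_JAV_J^\top:A\in\mathbb{R}^{r\times r}\}$ for $J\in\mathcal{J}$, and $\mathbb{R}_X(r)=\bigcup_{J\in\mathcal{J}}\mathbb{R}_X(J)$ (these depend on the chosen $U,V$). For $i=1,\dots,l$ define the $m\times n$ block matrices $$R^i_X=\begin{bmatrix}U_\Gamma^\top A^iV_\Gamma & 0\\ 0&0\end{bmatrix}.$$ *)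

theory Defs
  imports "HOL-Analysis.Analysis"
begin

subsection \<open>Numbering of matrix indices\<close>

text \<open>
  An \<open>m \<times> n\<close> matrix is a \<open>real^'n^'m\<close> with \<open>m = CARD('m)\<close> and \<open>n = CARD('n)\<close>. Rectangular
  diagonal matrices and leading blocks need the rows and columns to be numbered \<open>1, ..., m\<close> and
  \<open>1, ..., n\<close>; the numbering is the one given by a linear order on the index types.
  Numbers are 1-based throughout.
\<close>

definition pos :: "'a::{finite,linorder} \<Rightarrow> nat"
  where "pos i = card {..i}"

definition nth_elem :: "'a::linorder set \<Rightarrow> nat \<Rightarrow> 'a"
  where "nth_elem S p = sorted_list_of_set S ! (p - 1)"

definition idx :: "nat \<Rightarrow> 'a::{finite,linorder}"
  where "idx k = nth_elem UNIV k"

lemma pos_bij: "bij_betw (pos :: 'a::{finite,linorder} \<Rightarrow> nat) UNIV {1..CARD('a)}"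
proof -
  have inj: "inj (pos :: 'a \<Rightarrow> nat)"
  proof (rule injI)
    fix i j :: 'a
    have lt: "pos i < pos j" if "i < j" for i j :: 'a
      unfolding pos_def using that by (intro psubset_card_mono) auto
    assume "pos i = pos j"
    then show "i = j" using lt[of i j] lt[of j i] by (cases i j rule: linorder_cases) auto
  qed
  have sub: "range (pos :: 'a \<Rightarrow> nat) \<subseteq> {1..CARD('a)}"
    unfolding pos_def by (auto simp: Suc_le_eq card_gt_0_iff intro!: card_mono)
  have "range (pos :: 'a \<Rightarrow> nat) = {1..CARD('a)}"
    by (rule card_subset_eq) (use sub inj in \<open>auto simp: card_image\<close>)
  with inj show ?thesis by (auto simp: bij_betw_def)
qed

lemma pos_idx:
  assumes "1 \<le> k" "k \<le> CARD('a)"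
  shows "pos (idx k :: 'a::{finite,linorder}) = k"
proof -
  let ?xs = "sorted_list_of_set (UNIV :: 'a set)"
  have sorted: "sorted_wrt (<) ?xs" and len: "length ?xs = CARD('a)" and set: "set ?xs = UNIV"
    using strict_sorted_list_of_set[of "UNIV :: 'a set"] by auto
  have k: "k - 1 < length ?xs" using assms len by simp
  have le_iff: "?xs ! a \<le> ?xs ! b \<longleftrightarrow> a \<le> b" if "a < length ?xs" "b < length ?xs" for a b
    using sorted_wrt_nth_less[OF sorted, of a b] sorted_wrt_nth_less[OF sorted, of b a] that
    by (cases a b rule: linorder_cases) auto
  have "{..idx k} = (!) ?xs ` {..k - 1}"
  proof (intro equalityI subsetI)
    fix x :: 'a assume x: "x \<in> {..idx k}"
    obtain a where a: "a < length ?xs" "x = ?xs ! a"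
      using set by (metis UNIV_I in_set_conv_nth)
    with x le_iff[OF a(1) k] show "x \<in> (!) ?xs ` {..k - 1}"
      by (auto simp: idx_def nth_elem_def)
  next
    fix x assume "x \<in> (!) ?xs ` {..k - 1}"
    then obtain a where a: "a \<le> k - 1" "x = ?xs ! a" by auto
    then show "x \<in> {..idx k}"
      using le_iff[of a "k - 1"] k by (simp add: idx_def nth_elem_def)
  qed
  moreover have "inj_on ((!) ?xs) {..k - 1}"
    using k by (intro inj_on_nth) auto
  ultimately show ?thesis
    using assms by (simp add: pos_def card_image)
qed

text \<open>The \<open>p\<close>-th column of the submatrix \<open>U\<^sub>J\<close> consisting of the columns of \<open>U\<close> with number in \<open>J\<close>.\<close>

definition subcol :: "real^'k::{finite,linorder}^'m \<Rightarrow> nat set \<Rightarrow> nat \<Rightarrow> real^'m"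
  where "subcol U J p = column (idx (nth_elem J p)) U"


subsection \<open>Constraint sets, minimizers, tangent cones\<close>

definition affine_constraints ::
    "nat \<Rightarrow> (nat \<Rightarrow> real^'n^'m) \<Rightarrow> (nat \<Rightarrow> real) \<Rightarrow> (real^'n^'m) set"
  where "affine_constraints l A b = {X. \<forall>i\<in>{1..l}. A i \<bullet> X = b i}"

definition rank_le :: "nat \<Rightarrow> (real^'n^'m) set"
  where "rank_le r = {X. rank X \<le> r}"

definition local_minimizer :: "('a::metric_space \<Rightarrow> real) \<Rightarrow> 'a set \<Rightarrow> 'a \<Rightarrow> bool"
  where "local_minimizer f S x \<longleftrightarrow> x \<in> S \<and> (\<exists>e>0. \<forall>y\<in>S \<inter> ball x e. f x \<le> f y)"

definition bouligand_cone :: "'a::real_normed_vector set \<Rightarrow> 'a \<Rightarrow> 'a set"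
  where "bouligand_cone S x =
    {\<xi>. \<exists>(y :: nat \<Rightarrow> 'a) (t :: nat \<Rightarrow> real).
        (\<forall>k. y k \<in> S) \<and> y \<longlonglongrightarrow> x \<and> (\<forall>k. t k > 0) \<and> t \<longlonglongrightarrow> 0 \<and>
        (\<lambda>k. (y k - x) /\<^sub>R t k) \<longlonglongrightarrow> \<xi>}"


subsection \<open>Second derivatives\<close>

definition deriv_blinfun ::
    "('a::real_normed_vector \<Rightarrow> 'b::real_normed_vector) \<Rightarrow> 'a \<Rightarrow> 'a \<Rightarrow>\<^sub>L 'b"
  where "deriv_blinfun f x = Blinfun (frechet_derivative f (at x))"

lemma deriv_blinfun_eqI:
  "(f has_derivative blinfun_apply D) (at x) \<Longrightarrow> deriv_blinfun f x = D"
  unfolding deriv_blinfun_def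
  by (metis blinfun_apply_inverse frechet_derivative_at)

lemma has_derivative_deriv_blinfun:
  assumes "f differentiable (at x)"
  shows "(f has_derivative blinfun_apply (deriv_blinfun f x)) (at x)"
  using assms
  by (simp add: deriv_blinfun_def bounded_linear_Blinfun_apply frechet_derivative_works
      has_derivative_bounded_linear)

definition twice_continuously_differentiable ::
    "('a::real_normed_vector \<Rightarrow> 'b::real_normed_vector) \<Rightarrow> bool"
  where "twice_continuously_differentiable f \<longleftrightarrow>
    (\<forall>x. f differentiable (at x)) \<and>
    (\<forall>x. deriv_blinfun f differentiable (at x)) \<and>
    continuous_on UNIV (deriv_blinfun (deriv_blinfun f))"

definition hessian :: "('a::real_normed_vector \<Rightarrow> real) \<Rightarrow> 'a \<Rightarrow> 'a \<Rightarrow> 'a \<Rightarrow> real"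
  where "hessian f x u v =
    blinfun_apply (blinfun_apply (deriv_blinfun (deriv_blinfun f) x) u) v"


subsection \<open>Singular value decompositions and derived objects\<close>

text \<open>
  The singular values need not appear in decreasing order on the diagonal of \<open>S\<close>.
\<close>

definition is_svd ::
    "real^'m::{finite,linorder}^'m::{finite,linorder} \<Rightarrow> real^'n::{finite,linorder}^'m::{finite,linorder} \<Rightarrow> real^'n::{finite,linorder}^'n::{finite,linorder} \<Rightarrow> real^'n::{finite,linorder}^'m::{finite,linorder} \<Rightarrow> bool"
  where "is_svd U S V X \<longleftrightarrow>
    orthogonal_matrix U \<and> orthogonal_matrix V \<and>
    (\<forall>i j. S $ i $ j \<ge> 0) \<and> (\<forall>i j. pos i \<noteq> pos j \<longrightarrow> S $ i $ j = 0) \<and>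
    X = U ** S ** transpose V"

definition sv_support :: "real^'n::{finite,linorder}^'m::{finite,linorder} \<Rightarrow> nat set"
  where "sv_support S = {k\<in>{1..CARD('n)}. S $ idx k $ idx k \<noteq> 0}"

definition index_sets :: "nat \<Rightarrow> real^'n::{finite,linorder}^'m::{finite,linorder} \<Rightarrow> nat set set"
  where "index_sets r S = {J. J \<subseteq> {1..CARD('n)} \<and> card J = r \<and> sv_support S \<subseteq> J}"

text \<open>
  The set of all \<open>U\<^sub>J C V\<^sub>J\<^sup>T\<close> with \<open>C\<close> an \<open>r \<times> r\<close> matrix, the products being written
  out entrywise because \<open>r\<close> is a number, not a type; only \<open>C p q\<close> with \<open>1 \<le> p, q \<le> r\<close> matters.
\<close>

definition sing_subspace ::
    "real^'m::{finite,linorder}^'m::{finite,linorder} \<Rightarrow> real^'n::{finite,linorder}^'n::{finite,linorder} \<Rightarrow> nat \<Rightarrow> nat set \<Rightarrow> (real^'n::{finite,linorder}^'m::{finite,linorder}) set"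
  where "sing_subspace U V r J =
    {Y. \<exists>C :: nat \<Rightarrow> nat \<Rightarrow> real.
       Y = (\<chi> i j. \<Sum>p=1..r. \<Sum>q=1..r. subcol U J p $ i * C p q * subcol V J q $ j)}"

definition sing_union ::
    "real^'m::{finite,linorder}^'m::{finite,linorder} \<Rightarrow> real^'n::{finite,linorder}^'m::{finite,linorder} \<Rightarrow> real^'n::{finite,linorder}^'n::{finite,linorder} \<Rightarrow> nat \<Rightarrow> (real^'n::{finite,linorder}^'m::{finite,linorder}) set"
  where "sing_union U S V r = (\<Union>J\<in>index_sets r S. sing_subspace U V r J)"

text \<open>
  With \<open>\<Gamma> = sv_support S\<close>, the \<open>m \<times> n\<close> matrix whose leading \<open>|\<Gamma>| \<times> |\<Gamma>|\<close> block is
  \<open>U\<^sub>\<Gamma>\<^sup>T A V\<^sub>\<Gamma>\<close> and whose other entries vanish.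
\<close>

definition block_R ::
    "real^'m::{finite,linorder}^'m::{finite,linorder} \<Rightarrow> real^'n::{finite,linorder}^'m::{finite,linorder} \<Rightarrow> real^'n::{finite,linorder}^'n::{finite,linorder} \<Rightarrow> real^'n::{finite,linorder}^'m::{finite,linorder} \<Rightarrow> real^'n::{finite,linorder}^'m::{finite,linorder}"
  where "block_R U S V A =
    (\<chi> i j. if pos i \<le> card (sv_support S) \<and> pos j \<le> card (sv_support S)
           then subcol U (sv_support S) (pos i) \<bullet> (A *v subcol V (sv_support S) (pos j))
           else 0)"

text \<open>Linear independence of the family \<open>R 1, ..., R l\<close>; in particular its members are distinct.\<close>

definition independent_family :: "nat \<Rightarrow> (nat \<Rightarrow> 'a::real_vector) \<Rightarrow> bool"
  where "independent_family l R \<longleftrightarrow> inj_on R {1..l} \<and> independent (R ` {1..l})"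

definition assumption2 ::
    "real^'m::{finite,linorder}^'m::{finite,linorder} \<Rightarrow> real^'n::{finite,linorder}^'m::{finite,linorder} \<Rightarrow> real^'n::{finite,linorder}^'n::{finite,linorder} \<Rightarrow>
     nat \<Rightarrow> (nat \<Rightarrow> real^'n::{finite,linorder}^'m::{finite,linorder}) \<Rightarrow> bool"
  where "assumption2 U S V l A \<longleftrightarrow> independent_family l (\<lambda>i. block_R U S V (A i))"

end

theory Submission
  imports Defs
begin

text \<open>
  Each \<open>\<real>\<^sub>X(J)\<close> is a linear subspace of matrices of rank at most \<open>r\<close> that contains \<open>X\<close>, so the
  Bouligand cone at \<open>X\<close> of their finite union is contained in this union. A direction \<open>\<Xi>\<close> in both
  cones is therefore such that the whole line \<open>X + t \<Xi>\<close> is feasible, and the one-dimensional second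
  order necessary condition applies to \<open>f\<close> along this line.
\<close>

text \<open>If c were negative, g', which vanishes at the minimum 0, would be negative just to the
  right of 0. The mean value theorem then gives g h < g 0 for small h > 0, against
  minimality.\<close>

lemma second_derivative_nonneg_at_local_min:
  fixes g g' :: "real \<Rightarrow> real"
  assumes g: "\<And>t. (g has_real_derivative g' t) (at t)"
    and g': "(g' has_real_derivative c) (at 0)"
    and d: "d > 0" and min: "\<And>t. \<bar>t\<bar> < d \<Longrightarrow> g 0 \<le> g t"
  shows "c \<ge> 0"
proof (rule ccontr)
  assume "\<not> c \<ge> 0"
  then have "c < 0" by simp
  have "g' 0 = 0"
    using DERIV_local_min[OF g d] min by simp
  then obtain e where e: "e > 0" "\<And>h. 0 < h \<Longrightarrow> h < e \<Longrightarrow> g' h < 0"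
    using DERIV_neg_dec_right[OF g' \<open>c < 0\<close>] by auto
  define h where "h = min d e / 2"
  have h: "0 < h" "h < d" "h < e"
    using d e(1) by (auto simp: h_def)
  obtain z where z: "0 < z" "z < h" "g h - g 0 = (h - 0) * g' z"
    using MVT2[OF h(1) g] by blast
  have "h * g' z < 0"
    using h z e(2)[of z] by (intro mult_pos_neg) auto
  with z(3) min[of h] h show False by simp
qed

text \<open>The chain rule, applied to f and then to its derivative, identifies the second
  derivative of t \<mapsto> f (x + t u) at 0 with the Hessian at (u, u), so the one-dimensional
  criterion applies.\<close>

lemma hessian_nonneg_along_line:
  fixes f :: "'a::real_normed_vector \<Rightarrow> real"
  assumes f: "twice_continuously_differentiable f"
    and loc: "local_minimizer f S x"
    and line: "\<And>t. x + t *\<^sub>R u \<in> S"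
  shows "hessian f x u u \<ge> 0"
proof -
  define D where "D = deriv_blinfun f"
  have D: "(f has_derivative blinfun_apply (D y)) (at y)"
    and D2: "(D has_derivative blinfun_apply (deriv_blinfun D y)) (at y)" for y
    using f by (auto simp: D_def twice_continuously_differentiable_def
        intro: has_derivative_deriv_blinfun)
  have g: "((\<lambda>t. f (x + t *\<^sub>R u)) has_real_derivative D (x + t *\<^sub>R u) u) (at t)" for t
    unfolding has_field_derivative_def
    by (rule has_derivative_eq_rhs, rule has_derivative_compose[OF _ D])
      (auto intro!: derivative_eq_intros simp: blinfun.scaleR_right)
  \<comment> \<open>The base point stays in the form \<open>x + 0 *\<^sub>R u\<close> to match the
    composition rule; it is simplified to x below.\<close>
  have "((\<lambda>t. D (x + t *\<^sub>R u)) has_derivative (\<lambda>t. deriv_blinfun D (x + 0 *\<^sub>R u) (t *\<^sub>R u)))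
      (at (0::real))"
    by (rule has_derivative_compose[OF _ D2]) (auto intro!: derivative_eq_intros)
  \<comment> \<open>Evaluation of a bounded linear map at u is itself bounded linear, so it commutes
    with differentiation.\<close>
  from bounded_linear.has_derivative[OF blinfun.bounded_linear_left this]
  have g': "((\<lambda>t. D (x + t *\<^sub>R u) u) has_real_derivative hessian f x u u) (at 0)"
    unfolding has_field_derivative_def
    by (rule has_derivative_eq_rhs)
      (auto simp: hessian_def D_def blinfun.scaleR_right blinfun.scaleR_left)
  obtain e where e: "e > 0" "\<And>y. y \<in> S \<Longrightarrow> dist x y < e \<Longrightarrow> f x \<le> f y"
    using loc by (auto simp: local_minimizer_def)
  \<comment> \<open>The bound on t keeps x + t u within distance e of x; adding 1 keeps the
    denominator positive when u = 0.\<close>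
  have "f (x + 0 *\<^sub>R u) \<le> f (x + t *\<^sub>R u)" if "\<bar>t\<bar> < e / (norm u + 1)" for t
  proof -
    have "\<bar>t\<bar> * norm u \<le> \<bar>t\<bar> * (norm u + 1)"
      by (intro mult_left_mono) auto
    also have "\<dots> < e"
      using that by (simp add: pos_less_divide_eq add_nonneg_pos)
    finally show ?thesis
      using e(2)[OF line[of t]] by (simp add: dist_norm)
  qed
  moreover have "e / (norm u + 1) > 0"
    using e(1) by (simp add: add_nonneg_pos)
  ultimately show ?thesis
    using second_derivative_nonneg_at_local_min[OF g g'] by blast
qed

text \<open>A difference quotient at x stays in whichever subspace contains \<open>y k\<close>,
  since x lies in all of them. The subspace may change with k, but the finite union is closed and so
  contains the limit.\<close>

lemma bouligand_cone_Union_subspaces: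
  fixes x :: "'a::euclidean_space"
  assumes "finite F" and F: "\<And>T. T \<in> F \<Longrightarrow> subspace T \<and> x \<in> T"
  shows "bouligand_cone (\<Union>F) x \<subseteq> \<Union>F"
proof
  fix \<xi> assume "\<xi> \<in> bouligand_cone (\<Union>F) x"
  then obtain y t where y: "\<And>k :: nat. y k \<in> \<Union>F"
    and lim: "(\<lambda>k. (y k - x) /\<^sub>R t k) \<longlonglongrightarrow> \<xi>"
    by (auto simp: bouligand_cone_def)
  have "closed (\<Union>F)"
    using assms by (intro closed_Union) (auto intro: closed_subspace)
  moreover have "(y k - x) /\<^sub>R t k \<in> \<Union>F" for k
    using y[of k] F by (blast intro: subspace_diff subspace_scale)
  ultimately show "\<xi> \<in> \<Union>F"
    using lim by (intro Lim_in_closed_set[OF _ _ _ lim]) auto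
qed

lemma bouligand_cone_affine_constraints:
  assumes X: "X \<in> affine_constraints l A b"
    and \<Xi>: "\<Xi> \<in> bouligand_cone (affine_constraints l A b) X"
    and i: "i \<in> {1..l}"
  shows "A i \<bullet> \<Xi> = 0"
proof -
  obtain y t where y: "\<And>k :: nat. y k \<in> affine_constraints l A b"
    and lim: "(\<lambda>k. (y k - X) /\<^sub>R t k) \<longlonglongrightarrow> \<Xi>"
    using \<Xi> by (auto simp: bouligand_cone_def)
  have "(\<lambda>k. A i \<bullet> ((y k - X) /\<^sub>R t k)) \<longlonglongrightarrow> A i \<bullet> \<Xi>"
    by (intro tendsto_intros lim)
  moreover have "A i \<bullet> ((y k - X) /\<^sub>R t k) = 0" for k
    using y[of k] X i by (simp add: affine_constraints_def inner_diff_right)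
  ultimately have "(\<lambda>k :: nat. 0) \<longlonglongrightarrow> A i \<bullet> \<Xi>"
    by (simp only:)
  then show ?thesis
    by (simp add: LIMSEQ_const_iff)
qed

lemma subspace_sing_subspace: "subspace (sing_subspace U V r J)"
proof (rule subspaceI)
  show "0 \<in> sing_subspace U V r J"
    unfolding sing_subspace_def
    by (intro CollectI exI[of _ "\<lambda>_ _. 0"]) (simp add: vec_eq_iff)
next
  fix Y Z assume "Y \<in> sing_subspace U V r J" "Z \<in> sing_subspace U V r J"
  then obtain C D :: "nat \<Rightarrow> nat \<Rightarrow> real" where
    "Y = (\<chi> i j. \<Sum>p=1..r. \<Sum>q=1..r. subcol U J p $ i * C p q * subcol V J q $ j)"
    "Z = (\<chi> i j. \<Sum>p=1..r. \<Sum>q=1..r. subcol U J p $ i * D p q * subcol V J q $ j)"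
    unfolding sing_subspace_def by auto
  then show "Y + Z \<in> sing_subspace U V r J"
    unfolding sing_subspace_def
    by (intro CollectI exI[of _ "\<lambda>p q. C p q + D p q"])
      (simp add: vec_eq_iff sum.distrib algebra_simps)
next
  fix c Y assume "Y \<in> sing_subspace U V r J"
  then obtain C :: "nat \<Rightarrow> nat \<Rightarrow> real" where
    "Y = (\<chi> i j. \<Sum>p=1..r. \<Sum>q=1..r. subcol U J p $ i * C p q * subcol V J q $ j)"
    unfolding sing_subspace_def by auto
  then show "c *\<^sub>R Y \<in> sing_subspace U V r J"
    unfolding sing_subspace_def
    by (intro CollectI exI[of _ "\<lambda>p q. c * C p q"])
      (simp add: vec_eq_iff sum_distrib_left algebra_simps)
qed

text \<open>All columns of such a matrix are combinations of the same r vectors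
  \<open>subcol U J p\<close>, so the column space has dimension at most r.\<close>

lemma sing_subspace_subset_rank_le: "sing_subspace U V r J \<subseteq> rank_le r"
proof
  fix Y assume "Y \<in> sing_subspace U V r J"
  then obtain C :: "nat \<Rightarrow> nat \<Rightarrow> real" where
    Y: "Y = (\<chi> i j. \<Sum>p=1..r. \<Sum>q=1..r. subcol U J p $ i * C p q * subcol V J q $ j)"
    unfolding sing_subspace_def by auto
  have "column j Y \<in> span (subcol U J ` {1..r})" for j
  proof -
    have "column j Y = (\<Sum>p=1..r. (\<Sum>q=1..r. C p q * subcol V J q $ j) *\<^sub>R subcol U J p)"
      by (simp add: Y column_def vec_eq_iff sum_distrib_left sum_distrib_right mult_ac)
    then show ?thesis
      by (auto intro!: span_sum span_scale intro: span_base)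
  qed
  then have "columns Y \<subseteq> span (subcol U J ` {1..r})"
    by (auto simp: columns_def)
  then have "rank Y \<le> card (subcol U J ` {1..r})"
    unfolding column_rank_def by (intro dim_le_card) auto
  also have "\<dots> \<le> r"
    using card_image_le[of "{1..r}" "subcol U J"] by simp
  finally show "Y \<in> rank_le r"
    by (simp add: rank_le_def)
qed

text \<open>With \<open>sum_idx\<close> below, this translates between three indexings: positions p
  inside J, numbers k in J, and elements of the index type.\<close>

lemma sum_nth_elem:
  fixes J :: "'a::linorder set"
  assumes "finite J"
  shows "(\<Sum>p=1..card J. g (nth_elem J p)) = (\<Sum>k\<in>J. g k)"
proof -
  let ?xs = "sorted_list_of_set J"
  have "(\<Sum>p=1..card J. g (nth_elem J p)) = (\<Sum>p<length ?xs. g (?xs ! p))"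
    \<comment> \<open>Positions in J count from 1, list entries from 0.\<close>
    by (rule sum.reindex_bij_witness[where i=Suc and j="\<lambda>p. p - 1"]) (auto simp: nth_elem_def)
  also have "\<dots> = sum_list (map g ?xs)"
    by (simp add: sum_list_sum_nth atLeast0LessThan)
  also have "\<dots> = (\<Sum>k\<in>J. g k)"
    using assms by (simp add: sum_list_distinct_conv_sum_set)
  finally show ?thesis .
qed

lemma idx_pos: "idx (pos a) = (a :: 'a::{finite,linorder})"
proof -
  have "pos a \<in> {1..CARD('a)}"
    using pos_bij by (auto simp: bij_betw_def)
  then have "pos (idx (pos a) :: 'a) = pos a"
    by (intro pos_idx) auto
  then show ?thesis
    using pos_bij[where 'a='a] by (auto simp: bij_betw_def dest: injD)
qed

lemma sum_idx:
  assumes J: "J \<subseteq> {1..CARD('a)}"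
    and zero: "\<And>a. pos a \<notin> J \<Longrightarrow> g a = 0"
  shows "(\<Sum>k\<in>J. g (idx k)) = (\<Sum>a\<in>(UNIV :: 'a::{finite,linorder} set). g a)"
proof -
  have "(\<Sum>k\<in>J. g (idx k)) = (\<Sum>a | pos a \<in> J. g a)"
    using J by (intro sum.reindex_bij_witness[where i=pos and j=idx])
      (auto simp: idx_pos pos_idx subset_iff)
  also have "\<dots> = (\<Sum>a\<in>UNIV. g a)"
    using zero by (intro sum.mono_neutral_left) auto
  finally show ?thesis .
qed

text \<open>Every nonzero entry of S has its row and column number in \<Gamma>, hence in J. Cutting
  the double sum for U S V^T down to J therefore loses nothing. The assumption on the cardinalities
  makes J a set of valid row numbers too.\<close>

lemma svd_in_sing_subspace:
  fixes X S :: "real^'n::{finite,linorder}^'m::{finite,linorder}"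
  assumes le: "CARD('n) \<le> CARD('m)"
    and svd: "is_svd U S V X"
    and J: "J \<in> index_sets r S"
  shows "X \<in> sing_subspace U V r J"
proof -
  have Jn: "J \<subseteq> {1..CARD('n)}" and card: "card J = r" and sub: "sv_support S \<subseteq> J"
    using J by (auto simp: index_sets_def)
  then have Jm: "J \<subseteq> {1..CARD('m)}" and fin: "finite J"
    using le by (auto intro: finite_subset)
  have supp: "pos a \<in> J \<and> pos b \<in> J" if "S $ a $ b \<noteq> 0" for a b
  proof -
    have eq: "pos a = pos b"
      using svd that by (auto simp: is_svd_def)
    have "pos b \<in> {1..CARD('n)}"
      using pos_bij by (auto simp: bij_betw_def)
    \<comment> \<open>The two occurrences of \<open>idx\<close> have different types: the number
      shared by a and b is decoded once as a row and once as a column.\<close>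
    moreover have "idx (pos b) = a" "idx (pos b) = b"
      using eq idx_pos[of a] idx_pos[of b] by auto
    ultimately have "pos b \<in> sv_support S"
      using that by (simp add: sv_support_def)
    with sub eq show ?thesis by auto
  qed
  have "X $ i $ j = (\<Sum>p=1..r. \<Sum>q=1..r. subcol U J p $ i *
      S $ idx (nth_elem J p) $ idx (nth_elem J q) * subcol V J q $ j)" for i j
  proof -
    have "X $ i $ j = (\<Sum>b\<in>UNIV. \<Sum>a\<in>UNIV. U $ i $ a * S $ a $ b * V $ j $ b)"
      using svd by (simp add: is_svd_def matrix_matrix_mult_def transpose_def sum_distrib_right)
    also have "\<dots> = (\<Sum>a\<in>UNIV. \<Sum>b\<in>UNIV. U $ i $ a * S $ a $ b * V $ j $ b)"
      by (rule sum.swap)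
    also have "\<dots> = (\<Sum>a\<in>UNIV. \<Sum>k\<in>J. U $ i $ a * S $ a $ idx k * V $ j $ idx k)"
      using supp by (intro sum.cong refl sum_idx[symmetric] Jn) auto
    also have "\<dots> = (\<Sum>h\<in>J. \<Sum>k\<in>J. U $ i $ idx h * S $ idx h $ idx k * V $ j $ idx k)"
      using supp by (intro sum_idx[symmetric] Jm sum.neutral) auto
    also have "\<dots> = (\<Sum>p=1..card J. \<Sum>q=1..card J. U $ i $ idx (nth_elem J p) *
        S $ idx (nth_elem J p) $ idx (nth_elem J q) * V $ j $ idx (nth_elem J q))"
      by (simp only: sum_nth_elem[OF fin, symmetric])
    finally show ?thesis
      by (simp add: card subcol_def column_def)
  qed
  then show ?thesis
    unfolding sing_subspace_def
    \<comment> \<open>The coefficient matrix is the submatrix of S with rows and columns numbered by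
      J.\<close>
    by (intro CollectI exI[of _ "\<lambda>p q. S $ idx (nth_elem J p) $ idx (nth_elem J q)"])
      (simp add: vec_eq_iff)
qed

theorem theorem3p3:
  fixes f :: "real^'n::{finite,linorder}^'m::{finite,linorder} \<Rightarrow> real"
    and A :: "nat \<Rightarrow> real^'n::{finite,linorder}^'m::{finite,linorder}" and b :: "nat \<Rightarrow> real" and l r :: nat
    and X S :: "real^'n::{finite,linorder}^'m::{finite,linorder}" and U :: "real^'m::{finite,linorder}^'m::{finite,linorder}" and V :: "real^'n::{finite,linorder}^'n::{finite,linorder}"
  assumes "CARD('n) \<le> CARD('m)"
    and "1 \<le> r" and "r < CARD('n)"
    and "twice_continuously_differentiable f"
    and "X \<in> affine_constraints l A b \<inter> rank_le r"
    and "is_svd U S V X"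
    and "local_minimizer f (affine_constraints l A b \<inter> rank_le r) X"
    and "assumption2 U S V l A"
  shows "\<forall>\<Xi> \<in> bouligand_cone (affine_constraints l A b) X \<inter> bouligand_cone (sing_union U S V r) X.
    hessian f X \<Xi> \<Xi> \<ge> 0"
proof
  fix \<Xi> assume \<Xi>: "\<Xi> \<in> bouligand_cone (affine_constraints l A b) X \<inter> bouligand_cone (sing_union U S V r) X"
  let ?F = "sing_subspace U V r ` index_sets r S"
  have "finite (index_sets r S)"
    by (rule finite_subset[of _ "Pow {1..CARD('n)}"]) (auto simp: index_sets_def)
  then have "bouligand_cone (\<Union>?F) X \<subseteq> \<Union>?F"
    using assms(1,6)
    by (intro bouligand_cone_Union_subspaces) (auto intro: subspace_sing_subspace svd_in_sing_subspace)
  then obtain J where J: "J \<in> index_sets r S" "\<Xi> \<in> sing_subspace U V r J"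
    using \<Xi> by (auto simp: sing_union_def)
  have "X + t *\<^sub>R \<Xi> \<in> affine_constraints l A b \<inter> rank_le r" for t
  proof
    show "X + t *\<^sub>R \<Xi> \<in> affine_constraints l A b"
      using assms(5) \<Xi> bouligand_cone_affine_constraints[of X l A b \<Xi>]
      by (auto simp: affine_constraints_def inner_add_right)
    \<comment> \<open>X lies in the subspace of every admissible J, in particular in that of the J
      found for \<Xi>, so the whole line remains in one subspace.\<close>
    have "X + t *\<^sub>R \<Xi> \<in> sing_subspace U V r J"
      using svd_in_sing_subspace[OF assms(1,6) J(1)] J(2)
      by (intro subspace_add subspace_scale subspace_sing_subspace)
    then show "X + t *\<^sub>R \<Xi> \<in> rank_le r"
      using sing_subspace_subset_rank_le by blast
  qed
  with assms(4,7) show "hessian f X \<Xi> \<Xi> \<ge> 0"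
    by (rule hessian_nonneg_along_line)
qed

end
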